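(* Let $n=3$. A matrix $M\in\mathcal{M}_P$ minimizes $\mathrm{Vol}_1(\gamma_{M^{-1}})$ over $\mathcal{M}_P$ if and only if $M=A M_{1/3}A^\top$ for some $A\in\mathcal{A}$, where $$M_{1/3}=\begin{pmatrix} 1 & 0 & \frac13 \\ 0 & \frac13 & 0 \\ \frac13 & 0 & 1 \end{pmatrix}.$$ The minimum value of $\mathrm{Vol}_1(\gamma_{M^{-1}})$ over $\mathcal{M}_P$ is $4\pi\sqrt{2/3}$.
   Context: Let $f_P(x)=(1,x,x^2)^\top$ and $g_P(x)=f_P'(x)=(0,1,2x)^\top$. For a positive definite $3\times3$ matrix $\Sigma$, $$\mathrm{Vol}_1(\gamma_\Sigma)=2\int_{-\infty}^{\infty}\frac{\sqrt{(f_P(x)^\top\Sigma f_P(x))(g_P(x)^\top\Sigma g_P(x))-(f_P(x)^\top\Sigma g_P(x))^2}}{f_P(x)^\top\Sigma f_P(x)}\,dx .$$ $\mathcal{M}_P$ is the set of all positive definite $3\times3$ matrices of the form $\int_{\mathbb{R}} f_P(x)f_P(x)^\top\,d\rho(x)$ with $\rho$ a nonnegative finite measure on $\mathbb{R}$ for which the integral exists (equivalently, the set of positive definite $3\times 3$ Hankel matrices). $\mathcal{A}$ is the group of matrices $$A(a,b,c,d)=\begin{pmatrix} d^2 & 2cd & c^2 \\ bd & bc+ad & ac \\ b^2 & 2ab & a^2 \end{pmatrix},\qquad a,b,c,d\in\mathbb{R},\ ad-bc\neq0 .$$ *)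

theory Defs
  imports "HOL-Analysis.Analysis"
begin

definition fP :: "real \<Rightarrow> real^3" where
  "fP x = vector [1, x, x\<^sup>2]"

definition gP :: "real \<Rightarrow> real^3" where
  "gP x = vector [0, 1, 2 * x]"

lemma fP_has_vector_derivative: "(fP has_vector_derivative gP x) (at x)"
proof -
  have eq: "fP t = (\<chi> i. if i = 1 then 1 else if i = 2 then t else t\<^sup>2)" for t
    by (simp add: fP_def vec_eq_iff forall_3)
  have "((\<lambda>t. \<chi> i. if i = 1 then 1 else if i = 2 then t else t\<^sup>2) has_vector_derivative
      (gP x :: real^3)) (at x)"
    unfolding has_vector_derivative_def
    by (subst has_derivative_componentwise_within)
      (auto simp: Basis_vec_def inner_axis gP_def forall_3 intro!: derivative_eq_intros)
  then show ?thesis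
    by (simp add: eq[abs_def])
qed

definition pos_def_mat :: "real^'n^'n \<Rightarrow> bool" where
  "pos_def_mat M \<longleftrightarrow> transpose M = M \<and> (\<forall>v. v \<noteq> 0 \<longrightarrow> v \<bullet> (M *v v) > 0)"

text \<open>The integrand of \<open>Vol1\<close> is continuous and \<open>O(1/x\<^sup>2)\<close> at infinity whenever \<open>\<Sigma>\<close> is positive
  definite, so the Lebesgue integral does not take its default value on such matrices.\<close>

definition Vol1 :: "real^3^3 \<Rightarrow> real" where
  "Vol1 \<Sigma> = 2 * (\<integral>x.
     sqrt ((fP x \<bullet> (\<Sigma> *v fP x)) * (gP x \<bullet> (\<Sigma> *v gP x)) - (fP x \<bullet> (\<Sigma> *v gP x))\<^sup>2)
       / (fP x \<bullet> (\<Sigma> *v fP x)) \<partial>lborel)"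

definition outer_prod :: "real^'n \<Rightarrow> real^'m \<Rightarrow> real^'m^'n" where
  "outer_prod u v = (\<chi> i j. u $ i * v $ j)"

definition moment_matrices :: "(real^3^3) set" where
  "moment_matrices = {M. pos_def_mat M \<and>
     (\<exists>\<rho> :: real measure. finite_measure \<rho> \<and> sets \<rho> = sets borel \<and>
        integrable \<rho> (\<lambda>x. outer_prod (fP x) (fP x)) \<and>
        M = (\<integral>x. outer_prod (fP x) (fP x) \<partial>\<rho>))}"

definition A_mat :: "real \<Rightarrow> real \<Rightarrow> real \<Rightarrow> real \<Rightarrow> real^3^3" where
  "A_mat a b c d = vector [
     vector [d\<^sup>2, 2 * c * d, c\<^sup>2],
     vector [b * d, b * c + a * d, a * c],
     vector [b\<^sup>2, 2 * a * b, a\<^sup>2]]"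

definition A_group :: "(real^3^3) set" where
  "A_group = {A_mat a b c d | a b c d. a * d - b * c \<noteq> 0}"

definition M_third :: "real^3^3" where
  "M_third = vector [
     vector [1, 0, 1/3],
     vector [0, 1/3, 0],
     vector [1/3, 0, 1]]"

end

(*
  Cauchy-Binet turns the Gram determinant in the integrand of Vol1 (matrix_inv M) into a multiple
  of the binary quartic P(x) = E (x - s)^4, where E s^k are the moments in M, while the denominator
  is the Hessian H of P. Since Vol1 is invariant under Moebius substitutions, and since every
  positive definite Hankel matrix is congruent under the group to one with moments 1, 0, t, 0, 1
  and 1/3 <= t < 1, only the integral of sqrt P / H for P(x) = 1 + 6 t x^2 + x^4 has to be bounded.
  A combination of P and H is a multiple of (1 + x^2)^2, so sqrt P lies between 1 + x^2 and
  K (1 + x^2), with equal bounds only for t = 1/3. Replacing sqrt P by the chord of the square root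
  leaves rational functions, and the remaining inequality follows from AM-GM.
*)
theory Submission
  imports Defs "HOL-Probability.Sinc_Integral" "HOL-Computational_Algebra.Fundamental_Theorem_Algebra"
begin

section \<open>Moebius substitutions and a rational integral\<close>

text \<open>Change of variables off the null sets where \<open>c * x + d\<close> or
  \<open>a - c * y\<close> vanishes. Integrability passes both ways, so when it fails both Bochner
  integrals take the default value 0.\<close>

lemma lborel_integral_moebius:
  fixes f h :: "real \<Rightarrow> real"
  assumes D: "a * d - b * c \<noteq> 0"
    and [measurable]: "f \<in> borel_measurable borel" "h \<in> borel_measurable borel"
    and h: "\<And>x. c * x + d \<noteq> 0 \<Longrightarrow>
      h x = \<bar>(a * d - b * c) / (c * x + d)\<^sup>2\<bar> * f ((a * x + b) / (c * x + d))"
  shows "(\<integral>x. h x \<partial>lborel) = (\<integral>x. f x \<partial>lborel)"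
proof -
  define g where "g x = (a * x + b) / (c * x + d)" for x
  define g' where "g' x = (a * d - b * c) / (c * x + d)\<^sup>2" for x
  define S where "S = {x. c * x + d \<noteq> 0}"
  define T where "T = {y. a - c * y \<noteq> 0}"
  have [measurable]: "S \<in> sets borel" "T \<in> sets borel"
    unfolding S_def T_def by measurable
  have null: "AE x in lborel. p + q * x \<noteq> 0" if "p \<noteq> 0 \<or> q \<noteq> 0" for p q :: real
  proof (cases "q = 0")
    case False
    then have "p + q * x \<noteq> 0" if "x \<noteq> - p / q" for x
      using that by (auto simp: field_simps)
    with AE_lborel_singleton[of "- p / q"] show ?thesis
      by (auto elim: eventually_mono)
  qed (use that in auto)
  have im: "g ` S = T"
  proof
    show "g ` S \<subseteq> T"
    proof
      fix y assume "y \<in> g ` S"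
      then obtain x where x: "c * x + d \<noteq> 0" "y = g x"
        by (auto simp: S_def)
      have "(a - c * g x) * (c * x + d) = a * d - b * c"
        using x(1) by (simp add: g_def field_simps)
      with D x show "y \<in> T"
        by (auto simp: T_def)
    qed
    show "T \<subseteq> g ` S"
    proof
      fix y assume y: "y \<in> T"
      define x where "x = (d * y - b) / (a - c * y)"
      have *: "(c * x + d) * (a - c * y) = a * d - b * c"
        and "(a * x + b) * (a - c * y) = y * (a * d - b * c)"
        using y by (simp_all add: x_def T_def field_simps)
      then have "(a * x + b) * (a - c * y) = (y * (c * x + d)) * (a - c * y)"
        by simp
      moreover have "c * x + d \<noteq> 0"
        using * D by auto
      ultimately show "y \<in> g ` S"
        using y by (auto simp: S_def T_def g_def image_iff intro!: exI[of _ x])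
    qed
  qed
  have inj: "inj_on g S"
  proof (rule inj_onI)
    fix x y assume "x \<in> S" "y \<in> S" "g x = g y"
    then have "(a * x + b) * (c * y + d) = (a * y + b) * (c * x + d)"
      by (simp add: g_def S_def frac_eq_eq)
    then have "(a * d - b * c) * (x - y) = 0"
      by (simp add: algebra_simps)
    with D show "x = y" by simp
  qed
  have der: "(g has_field_derivative g' x) (at x within S)" if "x \<in> S" for x
    using that unfolding g_def g'_def S_def
    by (auto intro!: derivative_eq_intros simp: power2_eq_square algebra_simps)
  \<comment> \<open>Leaving the value \<open>r\<close> arbitrary transfers integrability and the
    value of the integral at once.\<close>
  have cov: "(\<lambda>x. \<bar>g' x\<bar> * f (g x)) absolutely_integrable_on S \<and>
      integral S (\<lambda>x. \<bar>g' x\<bar> * f (g x)) = r \<longleftrightarrow>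
      f absolutely_integrable_on T \<and> integral T f = r" for r
    using has_absolute_integral_change_of_variables_1'[OF _ der inj, of f r]
    unfolding im by simp
  have hS: "(\<lambda>x. \<bar>g' x\<bar> * f (g x)) absolutely_integrable_on S \<longleftrightarrow> h absolutely_integrable_on S"
    "integral S (\<lambda>x. \<bar>g' x\<bar> * f (g x)) = integral S h"
    unfolding set_integrable_def
    by (auto intro!: Bochner_Integration.integrable_cong_AE integral_cong arg_cong[where f="integrable lebesgue"]
        simp: h S_def g'_def g_def indicator_def)
  have to_set: "integrable lborel u \<longleftrightarrow> u absolutely_integrable_on A"
    "u absolutely_integrable_on A \<Longrightarrow> integral\<^sup>L lborel u = integral A u"
    if [measurable]: "A \<in> sets borel" "u \<in> borel_measurable borel" and A: "AE x in lborel. x \<in> A"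
    for A and u :: "real \<Rightarrow> real"
  proof -
    have ae: "AE x in lborel. u x = indicator A x *\<^sub>R u x"
      using A by eventually_elim auto
    have "integrable lborel u \<longleftrightarrow> integrable lborel (\<lambda>x. indicator A x *\<^sub>R u x)"
      by (rule integrable_cong_AE) (use ae in auto)
    then show "integrable lborel u \<longleftrightarrow> u absolutely_integrable_on A"
      by (simp add: set_integrable_def integrable_completion)
    assume "u absolutely_integrable_on A"
    then have "integral A u = integral\<^sup>L lebesgue (\<lambda>x. indicator A x *\<^sub>R u x)"
      using set_lebesgue_integral_eq_integral(2) by (metis set_lebesgue_integral_def)
    also have "\<dots> = integral\<^sup>L lborel (\<lambda>x. indicator A x *\<^sub>R u x)"
      by (simp add: integral_completion)
    also have "\<dots> = integral\<^sup>L lborel u"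
      by (rule integral_cong_AE) (use ae in auto)
    finally show "integral\<^sup>L lborel u = integral A u" by simp
  qed
  have "AE x in lborel. d + c * x \<noteq> 0" "AE x in lborel. a + (- c) * x \<noteq> 0"
    by (rule null; use D in auto)+
  then have aeS: "AE x in lborel. x \<in> S" and aeT: "AE x in lborel. x \<in> T"
    by (simp_all add: S_def T_def add.commute)
  have cov': "h absolutely_integrable_on S \<and> integral S h = r \<longleftrightarrow>
      f absolutely_integrable_on T \<and> integral T f = r" for r
    using cov[of r] unfolding hS .
  show ?thesis
  proof (rule integral_eq_cases)
    show "integrable lborel h \<longleftrightarrow> integrable lborel f"
      using cov' unfolding to_set(1)[OF _ assms(3) aeS, simplified] to_set(1)[OF _ assms(2) aeT, simplified]
      by blast
    assume "integrable lborel h" "integrable lborel f"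
    then have "h absolutely_integrable_on S" "f absolutely_integrable_on T"
      using to_set(1)[OF _ assms(3) aeS] to_set(1)[OF _ assms(2) aeT] by simp_all
    then show "integral\<^sup>L lborel h = integral\<^sup>L lborel f"
      using to_set(2)[OF _ assms(3) aeS] to_set(2)[OF _ assms(2) aeT] cov' by simp
  qed
qed

text \<open>An affine substitution in the integral of 1/(1 + x^2). The partial fractions of (1 +
  x^2) / \<open>hess t x\<close> have this shape.\<close>

lemma has_bochner_integral_inverse_quadratic:
  fixes p s :: real
  assumes "s > 0"
  shows "has_bochner_integral lborel (\<lambda>x. 1 / ((x - p)\<^sup>2 + s\<^sup>2)) (pi / s)"
proof -
  have "has_bochner_integral lborel (\<lambda>x::real. inverse (1 + x\<^sup>2)) pi"
    using integrable_inverse_1_plus_square LBINT_inverse_1_plus_square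
    by (simp add: has_bochner_integral_iff set_integrable_def interval_lebesgue_integral_def
        set_lebesgue_integral_def)
  then have "has_bochner_integral lborel (\<lambda>x. inverse (1 + (- (p / s) + (1 / s) * x)\<^sup>2)) (pi /\<^sub>R \<bar>1 / s\<bar>)"
    using assms by (subst lborel_has_bochner_integral_real_affine_iff[symmetric]) auto
  then have "has_bochner_integral lborel (\<lambda>x. (1 / s\<^sup>2) * inverse (1 + (- (p / s) + (1 / s) * x)\<^sup>2))
      ((1 / s\<^sup>2) * (pi /\<^sub>R \<bar>1 / s\<bar>))"
    by (rule has_bochner_integral_mult_right)
  moreover have "(1 / s\<^sup>2) * inverse (1 + (- (p / s) + (1 / s) * x)\<^sup>2) = 1 / ((x - p)\<^sup>2 + s\<^sup>2)" for x
  proof -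
    have "s\<^sup>2 * (1 + (- (p / s) + (1 / s) * x)\<^sup>2) = (x - p)\<^sup>2 + s\<^sup>2"
      using assms by (simp add: power2_eq_square field_simps)
    then show ?thesis
      by (metis inverse_eq_divide inverse_mult_distrib)
  qed
  moreover have "(1 / s\<^sup>2) * (pi /\<^sub>R \<bar>1 / s\<bar>) = pi / s"
    using assms by (simp add: power2_eq_square)
  ultimately show ?thesis by simp
qed

section \<open>Congruence by the group\<close>

lemma matrix_inv_unique:
  fixes A B :: "'a::field^'n^'n"
  assumes "A ** B = mat 1"
  shows "matrix_inv A = B"
proof -
  have BA: "B ** A = mat 1"
    using assms by (simp add: matrix_left_right_inverse)
  with assms have "\<exists>C. A ** C = mat 1 \<and> C ** A = mat 1"
    by blast
  then have "A ** matrix_inv A = mat 1 \<and> matrix_inv A ** A = mat 1"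
    unfolding matrix_inv_def by (rule someI_ex)
  then have "(B ** A) ** matrix_inv A = B"
    by (metis matrix_mul_assoc matrix_mul_rid)
  with BA show ?thesis by simp
qed

text \<open>The rows of \<open>A_mat a b c d\<close> list the coefficients of (c x + d)^2, (a x +
  b)(c x + d) and (a x + b)^2. It is thus the symmetric square of the 2x2 matrix with rows (a, b)
  and (c, d), hence multiplicative.\<close>

lemma A_mat_mult:
  "A_mat a b c d ** A_mat a' b' c' d' =
    A_mat (a * a' + b * c') (a * b' + b * d') (c * a' + d * c') (c * b' + d * d')"
  by (simp add: A_mat_def vec_eq_iff forall_3 matrix_matrix_mult_def sum_3 power2_eq_square algebra_simps)

lemma A_mat_1: "A_mat 1 0 0 1 = mat 1"
  by (simp add: A_mat_def vec_eq_iff forall_3 mat_def)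

lemma A_mat_inverse:
  assumes "a * d - b * c \<noteq> 0"
  defines "D \<equiv> a * d - b * c"
  shows "A_mat a b c d ** A_mat (d / D) (- b / D) (- c / D) (a / D) = mat 1"
    and "A_mat (d / D) (- b / D) (- c / D) (a / D) ** A_mat a b c d = mat 1"
proof -
  have "(a * d - b * c) / D = 1" "(d * a - c * b) / D = 1"
    using assms by (simp_all add: mult.commute)
  then have "a * (d / D) + b * (- c / D) = 1" "c * (- b / D) + d * (a / D) = 1"
      "a * (- b / D) + b * (a / D) = 0" "c * (d / D) + d * (- c / D) = 0"
    by (simp_all add: diff_divide_distrib mult.commute)
  then show "A_mat a b c d ** A_mat (d / D) (- b / D) (- c / D) (a / D) = mat 1"
    unfolding A_mat_mult by (simp only: A_mat_1)
  then show "A_mat (d / D) (- b / D) (- c / D) (a / D) ** A_mat a b c d = mat 1"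
    by (simp add: matrix_left_right_inverse)
qed

lemma A_group_inverse:
  assumes "A \<in> A_group"
  obtains B where "B \<in> A_group" "A ** B = mat 1" "B ** A = mat 1"
proof -
  from assms obtain a b c d where A: "A = A_mat a b c d" and D: "a * d - b * c \<noteq> 0"
    by (auto simp: A_group_def)
  let ?D = "a * d - b * c"
  have "(d / ?D) * (a / ?D) - (- b / ?D) * (- c / ?D) = ?D / (?D * ?D)"
    by (simp add: diff_divide_distrib mult.commute)
  then have "A_mat (d / ?D) (- b / ?D) (- c / ?D) (a / ?D) \<in> A_group"
    using D unfolding A_group_def by force
  with A_mat_inverse[OF D] A that show thesis by blast
qed

lemma A_group_mult:
  assumes "A \<in> A_group" "B \<in> A_group"
  shows "A ** B \<in> A_group"
proof -
  from assms obtain a b c d a' b' c' d'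
    where A: "A = A_mat a b c d" "a * d - b * c \<noteq> 0"
      and B: "B = A_mat a' b' c' d'" "a' * d' - b' * c' \<noteq> 0"
    by (auto simp: A_group_def)
  have "(a * a' + b * c') * (c * b' + d * d') - (a * b' + b * d') * (c * a' + d * c') =
      (a * d - b * c) * (a' * d' - b' * c')"
    by algebra
  then show ?thesis
    using A B unfolding A_group_def A(1) B(1) A_mat_mult by force
qed

section \<open>Congruence, positive definiteness and invariance of the volume\<close>

lemma inner_transpose_mult:
  fixes A :: "real^'n^'m"
  shows "u \<bullet> (transpose A *v w) = (A *v u) \<bullet> w"
  by (metis dot_lmul_matrix vector_transpose_matrix)

lemma pos_def_mat_congruence:
  fixes A M :: "real^'n^'n"
  assumes "pos_def_mat M" "A ** B = mat 1"
  shows "pos_def_mat (A ** M ** transpose A)"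
  unfolding pos_def_mat_def
proof (intro conjI allI impI)
  show "transpose (A ** M ** transpose A) = A ** M ** transpose A"
    using assms(1) by (simp add: pos_def_mat_def matrix_transpose_mul matrix_mul_assoc)
  fix v :: "real^'n" assume "v \<noteq> 0"
  have "transpose B ** transpose A = mat 1"
    using assms(2) by (metis matrix_transpose_mul transpose_mat)
  then have "transpose A *v v \<noteq> 0"
    using \<open>v \<noteq> 0\<close> by (metis matrix_vector_mul_assoc matrix_vector_mul_lid matrix_vector_mult_0_right)
  moreover have "v \<bullet> ((A ** M ** transpose A) *v v) = (transpose A *v v) \<bullet> (M *v (transpose A *v v))"
    using inner_transpose_mult[of v "transpose A"]
    by (simp add: matrix_vector_mul_assoc[symmetric] del: transpose_matrix_vector)
  ultimately show "0 < v \<bullet> ((A ** M ** transpose A) *v v)"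
    using assms(1) by (simp add: pos_def_mat_def)
qed

lemma symmetric_matrix_inv:
  fixes M :: "real^'n^'n"
  assumes "transpose M = M" "M ** N = mat 1"
  shows "transpose N = N"
  by (metis assms matrix_left_right_inverse matrix_mul_assoc matrix_mul_lid matrix_mul_rid
      matrix_transpose_mul transpose_mat)

text \<open>Up to the factor \<open>(c x + d)\<^sup>2\<close>, the matrix \<open>A_mat a b c d\<close> moves the curve \<open>fP\<close> along
  itself by a Moebius map, and \<open>Vol1\<close> only depends on the projectivized curve.\<close>

lemma A_mat_fP:
  assumes "c * x + d \<noteq> 0"
  shows "A_mat a b c d *v fP x = (c * x + d)\<^sup>2 *\<^sub>R fP ((a * x + b) / (c * x + d))"
proof -
  define y where "y = (a * x + b) / (c * x + d)"
  have "y * (c * x + d) = a * x + b"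
    using assms by (simp add: y_def)
  then have "b * d + (b * c + a * d) * x + a * c * x\<^sup>2 = (c * x + d)\<^sup>2 * y"
    "b\<^sup>2 + 2 * a * b * x + a\<^sup>2 * x\<^sup>2 = (c * x + d)\<^sup>2 * y\<^sup>2"
    by algebra+
  moreover have "d\<^sup>2 + 2 * c * d * x + c\<^sup>2 * x\<^sup>2 = (c * x + d)\<^sup>2"
    by algebra
  ultimately show ?thesis
    unfolding y_def[symmetric]
    by (simp add: A_mat_def fP_def vec_eq_iff forall_3 matrix_vector_mult_def sum_3)
qed

lemma A_mat_gP:
  assumes "c * x + d \<noteq> 0"
  shows "A_mat a b c d *v gP x = (2 * c * (c * x + d)) *\<^sub>R fP ((a * x + b) / (c * x + d))
     + (a * d - b * c) *\<^sub>R gP ((a * x + b) / (c * x + d))"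
proof -
  define y where "y = (a * x + b) / (c * x + d)"
  have "y * (c * x + d) = a * x + b"
    using assms by (simp add: y_def)
  then have "(b * c + a * d) + a * c * (2 * x) = 2 * c * (c * x + d) * y + (a * d - b * c)"
    "2 * a * b + a\<^sup>2 * (2 * x) = 2 * c * (c * x + d) * y\<^sup>2 + (a * d - b * c) * (2 * y)"
    by algebra+
  moreover have "2 * c * d + c\<^sup>2 * (2 * x) = 2 * c * (c * x + d)"
    by algebra
  ultimately show ?thesis
    unfolding y_def[symmetric]
    by (simp add: A_mat_def fP_def gP_def vec_eq_iff forall_3 matrix_vector_mult_def sum_3)
qed

text \<open>By the two preceding lemmas \<open>A\<close> sends the pair \<open>fP\<close>,
  \<open>gP\<close> at \<open>x\<close> to a triangular combination of the same pair at the image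
  point. The integrand therefore changes exactly by the Jacobian of the Moebius map.\<close>

lemma Vol1_congruence:
  assumes sym: "transpose \<Sigma> = \<Sigma>" and A: "A \<in> A_group"
  shows "Vol1 (transpose A ** \<Sigma> ** A) = Vol1 \<Sigma>"
proof -
  define F where "F \<Sigma> x = sqrt ((fP x \<bullet> (\<Sigma> *v fP x)) * (gP x \<bullet> (\<Sigma> *v gP x)) - (fP x \<bullet> (\<Sigma> *v gP x))\<^sup>2)
       / (fP x \<bullet> (\<Sigma> *v fP x))" for \<Sigma> :: "real^3^3" and x
  have F_meas: "F \<Sigma> \<in> borel_measurable borel" for \<Sigma>
    unfolding F_def fP_def gP_def
    by (simp add: inner_vec_def matrix_vector_mult_def sum_3) measurable
  from A obtain a b c d where A: "A = A_mat a b c d" and D: "a * d - b * c \<noteq> 0"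
    by (auto simp: A_group_def)
  have bil: "u \<bullet> ((transpose A ** \<Sigma> ** A) *v v) = (A *v u) \<bullet> (\<Sigma> *v (A *v v))" for u v
    by (simp add: inner_transpose_mult matrix_vector_mul_assoc[symmetric] del: transpose_matrix_vector)
  have comm: "u \<bullet> (\<Sigma> *v v) = v \<bullet> (\<Sigma> *v u)" for u v
    by (metis dot_lmul_matrix inner_commute sym vector_transpose_matrix)
  have "F (transpose A ** \<Sigma> ** A) x =
      \<bar>(a * d - b * c) / (c * x + d)\<^sup>2\<bar> * F \<Sigma> ((a * x + b) / (c * x + d))" if "c * x + d \<noteq> 0" for x
  proof -
    define k m e where "k = c * x + d" and "m = 2 * c * (c * x + d)" and "e = a * d - b * c"
    define f where "f = fP ((a * x + b) / (c * x + d))"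
    define g where "g = gP ((a * x + b) / (c * x + d))"
    define p q r where "p = f \<bullet> (\<Sigma> *v f)" and "q = f \<bullet> (\<Sigma> *v g)" and "r = g \<bullet> (\<Sigma> *v g)"
    have gf: "g \<bullet> (\<Sigma> *v f) = q"
      using comm q_def by simp
    have Af: "A *v fP x = k\<^sup>2 *\<^sub>R f" and Ag: "A *v gP x = m *\<^sub>R f + e *\<^sub>R g"
      using A_mat_fP[OF that] A_mat_gP[OF that] by (simp_all add: A f_def g_def k_def m_def e_def)
    let ?N = "transpose A ** \<Sigma> ** A"
    have ff: "fP x \<bullet> (?N *v fP x) = (k\<^sup>2)\<^sup>2 * p"
      and fg: "fP x \<bullet> (?N *v gP x) = k\<^sup>2 * (m * p + e * q)"
      and gg: "gP x \<bullet> (?N *v gP x) = m\<^sup>2 * p + 2 * m * e * q + e\<^sup>2 * r"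
      unfolding bil Af Ag matrix_vector_right_distrib matrix_vector_mult_scaleR
      by (simp_all add: inner_add_left inner_add_right gf p_def[symmetric] q_def[symmetric]
          r_def[symmetric] power2_eq_square algebra_simps)
    \<comment> \<open>Adding a multiple of \<open>f\<close> to the second vector leaves a Gram
      determinant unchanged; only the scalings \<open>k\<^sup>2\<close> and \<open>e\<close>
      remain.\<close>
    have gram: "(k\<^sup>2)\<^sup>2 * p * (m\<^sup>2 * p + 2 * m * e * q + e\<^sup>2 * r) - (k\<^sup>2 * (m * p + e * q))\<^sup>2
        = (k\<^sup>2 * e)\<^sup>2 * (p * r - q\<^sup>2)"
      by algebra
    have "F ?N x = sqrt ((k\<^sup>2 * e)\<^sup>2 * (p * r - q\<^sup>2)) / ((k\<^sup>2)\<^sup>2 * p)"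
      by (simp only: F_def ff fg gg gram)
    also have "\<dots> = \<bar>e / k\<^sup>2\<bar> * (sqrt (p * r - q\<^sup>2) / p)"
    proof -
      have "\<bar>w * e\<bar> * s / (w\<^sup>2 * p) = \<bar>e / w\<bar> * (s / p)" if "w > 0" for w s
        using that by (simp add: abs_mult power2_eq_square)
      moreover have "k\<^sup>2 > 0" using that by (simp add: k_def)
      ultimately show ?thesis
        unfolding real_sqrt_mult real_sqrt_abs by blast
    qed
    also have "sqrt (p * r - q\<^sup>2) / p = F \<Sigma> ((a * x + b) / (c * x + d))"
      by (simp add: F_def p_def q_def r_def f_def g_def)
    finally show ?thesis
      unfolding e_def k_def .
  qed
  then have "integral\<^sup>L lborel (F (transpose A ** \<Sigma> ** A)) = integral\<^sup>L lborel (F \<Sigma>)"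
    by (rule lborel_integral_moebius[OF D F_meas F_meas])
  then show ?thesis
    unfolding Vol1_def F_def by simp
qed

text \<open>The inverse of a congruent matrix is congruent by the inverse group element, so the
  invariance applies to it.\<close>

lemma Vol1_matrix_inv_congruence:
  assumes sym: "transpose M = M" and inv: "M ** N = mat 1" and A: "A \<in> A_group"
  shows "Vol1 (matrix_inv (A ** M ** transpose A)) = Vol1 N"
proof -
  from A obtain B where B: "B \<in> A_group" "A ** B = mat 1" "B ** A = mat 1"
    by (rule A_group_inverse)
  have "transpose A ** transpose B = mat 1"
    by (metis B(3) matrix_transpose_mul transpose_mat)
  then have "(A ** M ** transpose A) ** (transpose B ** N ** B) = mat 1"
    using inv B(2) by (metis matrix_mul_assoc matrix_mul_rid)
  then have "matrix_inv (A ** M ** transpose A) = transpose B ** N ** B"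
    by (rule matrix_inv_unique)
  with Vol1_congruence[OF symmetric_matrix_inv[OF sym inv] B(1)] show ?thesis by simp
qed

section \<open>Normal form of positive definite Hankel matrices\<close>

definition hankel :: "real \<Rightarrow> real \<Rightarrow> real \<Rightarrow> real \<Rightarrow> real \<Rightarrow> real^3^3" where
  "hankel m0 m1 m2 m3 m4 = vector [vector [m0, m1, m2], vector [m1, m2, m3], vector [m2, m3, m4]]"

text \<open>With \<open>m0\<close> to \<open>m4\<close> read as moments E s^k, the new entries are E
  (c s + d)^(4-k) (a s + b)^k for k = 0 to 4, which is why the Hankel shape survives.\<close>

lemma hankel_congruence:
  "A_mat a b c d ** hankel m0 m1 m2 m3 m4 ** transpose (A_mat a b c d) = hankel
    (d^4 * m0 + 4 * c * d^3 * m1 + 6 * c\<^sup>2 * d\<^sup>2 * m2 + 4 * c^3 * d * m3 + c^4 * m4)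
    (b * d^3 * m0 + (3 * b * c * d\<^sup>2 + a * d^3) * m1 + (3 * b * c\<^sup>2 * d + 3 * a * c * d\<^sup>2) * m2
      + (b * c^3 + 3 * a * c\<^sup>2 * d) * m3 + a * c^3 * m4)
    (b\<^sup>2 * d\<^sup>2 * m0 + (2 * a * b * d\<^sup>2 + 2 * b\<^sup>2 * c * d) * m1
      + (a\<^sup>2 * d\<^sup>2 + 4 * a * b * c * d + b\<^sup>2 * c\<^sup>2) * m2 + (2 * a\<^sup>2 * c * d + 2 * a * b * c\<^sup>2) * m3
      + a\<^sup>2 * c\<^sup>2 * m4)
    (b^3 * d * m0 + (3 * a * b\<^sup>2 * d + b^3 * c) * m1 + (3 * a\<^sup>2 * b * d + 3 * a * b\<^sup>2 * c) * m2
      + (a^3 * d + 3 * a\<^sup>2 * b * c) * m3 + a^3 * c * m4)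
    (b^4 * m0 + 4 * a * b^3 * m1 + 6 * a\<^sup>2 * b\<^sup>2 * m2 + 4 * a^3 * b * m3 + a^4 * m4)"
  by (simp add: A_mat_def hankel_def vec_eq_iff forall_3 matrix_matrix_mult_def transpose_def sum_3
      power2_eq_square power3_eq_cube power4_eq_xxxx algebra_simps)

lemma hankel_form:
  "vector [u, v, w] \<bullet> (hankel m0 m1 m2 m3 m4 *v vector [u, v, w]) =
    m0 * u\<^sup>2 + 2 * m1 * u * v + m2 * (v\<^sup>2 + 2 * u * w) + 2 * m3 * v * w + m4 * w\<^sup>2"
  by (simp add: hankel_def inner_vec_def matrix_vector_mult_def sum_3 power2_eq_square algebra_simps)

text \<open>In moment notation the form is E (u + v s + w s^2)^2, so positivity can be tested on
  chosen quadratics.\<close>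

lemma pos_def_hankel:
  assumes "pos_def_mat (hankel m0 m1 m2 m3 m4)" "u \<noteq> 0 \<or> v \<noteq> 0 \<or> w \<noteq> 0"
  shows "0 < m0 * u\<^sup>2 + 2 * m1 * u * v + m2 * (v\<^sup>2 + 2 * u * w) + 2 * m3 * v * w + m4 * w\<^sup>2"
proof -
  have "(vector [u, v, w] :: real^3) \<noteq> 0"
    using assms(2) by (auto simp: vec_eq_iff forall_3)
  with assms(1) show ?thesis
    unfolding pos_def_mat_def by (metis hankel_form)
qed

section \<open>Orbits under congruence and reduction to one parameter\<close>

definition orbit_rel :: "real^3^3 \<Rightarrow> real^3^3 \<Rightarrow> bool" where
  "orbit_rel M N \<longleftrightarrow> (\<exists>A\<in>A_group. N = A ** M ** transpose A)"

lemma orbit_rel_sym: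
  assumes "orbit_rel M N"
  shows "orbit_rel N M"
proof -
  from assms obtain A where A: "A \<in> A_group" "N = A ** M ** transpose A"
    by (auto simp: orbit_rel_def)
  then obtain B where B: "B \<in> A_group" "A ** B = mat 1" "B ** A = mat 1"
    by (metis A_group_inverse)
  then have "transpose A ** transpose B = mat 1"
    by (metis matrix_transpose_mul transpose_mat)
  then have "M = B ** N ** transpose B"
    using A(2) B(3) by (metis matrix_mul_assoc matrix_mul_lid matrix_mul_rid)
  with B(1) show ?thesis
    by (auto simp: orbit_rel_def)
qed

lemma orbit_rel_trans:
  assumes "orbit_rel L M" "orbit_rel M N"
  shows "orbit_rel L N"
proof -
  from assms obtain A B where "A \<in> A_group" "M = A ** L ** transpose A"
      "B \<in> A_group" "N = B ** M ** transpose B"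
    by (auto simp: orbit_rel_def)
  then have "B ** A \<in> A_group" "N = (B ** A) ** L ** transpose (B ** A)"
    by (simp_all add: A_group_mult matrix_transpose_mul matrix_mul_assoc)
  then show ?thesis
    by (auto simp: orbit_rel_def)
qed

lemma orbit_rel_pos_def:
  assumes "orbit_rel M N" "pos_def_mat M"
  shows "pos_def_mat N"
  using assms by (auto simp: orbit_rel_def intro: pos_def_mat_congruence elim: A_group_inverse)

lemma orbit_rel_A_mat: "a * d - b * c \<noteq> 0 \<Longrightarrow> orbit_rel M (A_mat a b c d ** M ** transpose (A_mat a b c d))"
  unfolding orbit_rel_def A_group_def by blast

text \<open>If \<open>M\<close> has moments \<open>E s\<^sup>k\<close>, then \<open>E (x - s)\<^sup>4\<close> is a positive quartic in \<open>x\<close>. The affine map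
  moving one of its complex roots to the imaginary unit yields the two linear relations.\<close>

lemma hankel_orbit_root_at_i:
  assumes pd: "pos_def_mat (hankel m0 m1 m2 m3 m4)"
  obtains n0 n1 n2 n4 where "orbit_rel (hankel m0 m1 m2 m3 m4) (hankel n0 n1 n2 n1 n4)"
    "n0 + n4 = 6 * n2"
proof -
  have "m0 > 0"
    using pos_def_hankel[OF pd, of 1 0 0] by simp
  \<comment> \<open>The quartic E (x - s)^4, expanded in powers of x.\<close>
  define P :: "complex poly" where
    "P = [:of_real m4, of_real (- 4 * m3), of_real (6 * m2), of_real (- 4 * m1), of_real m0:]"
  have "degree P \<noteq> 0"
    using \<open>m0 > 0\<close> by (simp add: P_def)
  then obtain z where z: "poly P z = 0"
    using Fundamental_Theorem_Algebra.fundamental_theorem_of_algebra[of P] constant_degree[of P]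
    by auto
  define p q where "p = Re z" and "q = Im z"
  have zpq: "z = Complex p q"
    by (simp add: p_def q_def)
  have re: "m4 - 4 * m3 * p + 6 * m2 * (p\<^sup>2 - q\<^sup>2) - 4 * m1 * (p^3 - 3 * p * q\<^sup>2)
      + m0 * (p^4 - 6 * p\<^sup>2 * q\<^sup>2 + q^4) = 0"
    using arg_cong[OF z, of Re] unfolding P_def zpq
    by (simp add: power2_eq_square power3_eq_cube power4_eq_xxxx algebra_simps)
  have im: "q * (- 4 * m3 + 12 * m2 * p - 4 * m1 * (3 * p\<^sup>2 - q\<^sup>2) + m0 * (4 * p^3 - 4 * p * q\<^sup>2)) = 0"
    using arg_cong[OF z, of Im] unfolding P_def zpq
    by (simp add: power2_eq_square power3_eq_cube power4_eq_xxxx algebra_simps)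
  \<comment> \<open>A real root \<open>p\<close> would make E (p - s)^4 vanish, but this is the form
    at the quadratic (p - s)^2.\<close>
  have "q \<noteq> 0"
  proof
    assume "q = 0"
    with re pos_def_hankel[OF pd, of "p\<^sup>2" "- 2 * p" 1] show False
      by (simp add: power2_eq_square power3_eq_cube power4_eq_xxxx algebra_simps)
  qed
  with im have im: "- 4 * m3 + 12 * m2 * p - 4 * m1 * (3 * p\<^sup>2 - q\<^sup>2) + m0 * (4 * p^3 - 4 * p * q\<^sup>2) = 0"
    by simp
  \<comment> \<open>These are q^(4-k) E (s - p)^k, the moments after the substitution (s - p) / q,
    which carries the root \<open>z\<close> to the imaginary unit.\<close>
  define n0 where "n0 = q^4 * m0"
  define n1 where "n1 = q^3 * (m1 - p * m0)"
  define n2 where "n2 = q\<^sup>2 * (m2 - 2 * p * m1 + p\<^sup>2 * m0)"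
  define n3 where "n3 = q * (m3 - 3 * p * m2 + 3 * p\<^sup>2 * m1 - p^3 * m0)"
  define n4 where "n4 = m4 - 4 * p * m3 + 6 * p\<^sup>2 * m2 - 4 * p^3 * m1 + p^4 * m0"
  have "A_mat 1 (- p) 0 q ** hankel m0 m1 m2 m3 m4 ** transpose (A_mat 1 (- p) 0 q) =
      hankel n0 n1 n2 n3 n4"
    unfolding hankel_congruence n0_def n1_def n2_def n3_def n4_def
    by (simp add: algebra_simps)
  then have "orbit_rel (hankel m0 m1 m2 m3 m4) (hankel n0 n1 n2 n3 n4)"
    using orbit_rel_A_mat[of 1 q "- p" 0 "hankel m0 m1 m2 m3 m4"] \<open>q \<noteq> 0\<close> by simp
  moreover have "4 * n3 = 4 * n1"
    using im unfolding n1_def n3_def by algebra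
  moreover have "n0 + n4 = 6 * n2"
    using re unfolding n0_def n2_def n4_def by algebra
  ultimately show thesis
    using that by simp
qed

text \<open>Rotations fix the imaginary unit, so both linear relations persist. On matrices
  satisfying them, the pair (n4 - n0, 4 n1) turns by twice the rotation angle, so the odd moments
  can be made zero.\<close>

lemma hankel_orbit_even:
  assumes "n0 + n4 = 6 * n2"
  obtains k0 k2 k4 where "orbit_rel (hankel n0 n1 n2 n1 n4) (hankel k0 0 k2 0 k4)"
    "k0 + k4 = 6 * k2"
proof -
  obtain r w where rw: "n4 - n0 = r * cos w" "4 * n1 = r * sin w"
    using polar_Ex by blast
  \<comment> \<open>The rotation angle is minus half the polar angle of that pair.\<close>
  define C S where "C = cos (w / 2)" and "S = - sin (w / 2)"
  have cs: "C\<^sup>2 + S\<^sup>2 = 1"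
    by (simp add: C_def S_def)
  have "cos w = C\<^sup>2 - S\<^sup>2" "sin w = - (2 * S * C)"
    using cos_double[of "w / 2"] sin_double[of "w / 2"] by (simp_all add: C_def S_def)
  with rw have eq: "4 * n1 * (C\<^sup>2 - S\<^sup>2) + (n4 - n0) * (2 * S * C) = 0"
    by algebra
  let ?A = "A_mat C (- S) S C"
  obtain k0 k1 k2 k3 k4 where k: "?A ** hankel n0 n1 n2 n1 n4 ** transpose ?A = hankel k0 k1 k2 k3 k4"
    and kd: "k0 = C^4 * n0 + 4 * S * C^3 * n1 + 6 * S\<^sup>2 * C\<^sup>2 * n2 + 4 * S^3 * C * n1 + S^4 * n4"
    "k1 = - S * C^3 * n0 + (3 * - S * S * C\<^sup>2 + C * C^3) * n1
      + (3 * - S * S\<^sup>2 * C + 3 * C * S * C\<^sup>2) * n2 + (- S * S^3 + 3 * C * S\<^sup>2 * C) * n1 + C * S^3 * n4"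
    "k2 = (- S)\<^sup>2 * C\<^sup>2 * n0 + (2 * C * - S * C\<^sup>2 + 2 * (- S)\<^sup>2 * S * C) * n1
      + (C\<^sup>2 * C\<^sup>2 + 4 * C * - S * S * C + (- S)\<^sup>2 * S\<^sup>2) * n2
      + (2 * C\<^sup>2 * S * C + 2 * C * - S * S\<^sup>2) * n1 + C\<^sup>2 * S\<^sup>2 * n4"
    "k3 = (- S)^3 * C * n0 + (3 * C * (- S)\<^sup>2 * C + (- S)^3 * S) * n1
      + (3 * C\<^sup>2 * - S * C + 3 * C * (- S)\<^sup>2 * S) * n2 + (C^3 * C + 3 * C\<^sup>2 * - S * S) * n1 + C^3 * S * n4"
    "k4 = (- S)^4 * n0 + 4 * C * (- S)^3 * n1 + 6 * C\<^sup>2 * (- S)\<^sup>2 * n2 + 4 * C^3 * - S * n1 + C^4 * n4"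
    by (rule that[OF hankel_congruence refl refl refl refl refl])
  have n0: "n0 = 6 * n2 - n4"
    using assms by simp
  have "4 * k1 = (C\<^sup>2 + S\<^sup>2) * (4 * n1 * (C\<^sup>2 - S\<^sup>2) + (n4 - n0) * (2 * S * C))"
    "4 * k3 = (C\<^sup>2 + S\<^sup>2) * (4 * n1 * (C\<^sup>2 - S\<^sup>2) + (n4 - n0) * (2 * S * C))"
    "k0 + k4 = 6 * k2"
    unfolding kd n0 by algebra+
  with eq have "k1 = 0" "k3 = 0" "k0 + k4 = 6 * k2"
    by simp_all
  moreover have "orbit_rel (hankel n0 n1 n2 n1 n4) (hankel k0 k1 k2 k3 k4)"
  proof -
    have "C * C - - S * S \<noteq> 0"
      using cs by (simp add: power2_eq_square)
    from orbit_rel_A_mat[OF this, of "hankel n0 n1 n2 n1 n4"] show ?thesis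
      unfolding k .
  qed
  ultimately show thesis
    using that by simp
qed

text \<open>A diagonal scaling makes the outer moments 1. The relation between the moments then
  writes \<open>6 * t - 2\<close> as a square up to a positive factor, and testing the form on 1 -
  s^2 gives \<open>t < 1\<close>.\<close>

lemma hankel_orbit_normal_form:
  assumes "pos_def_mat (hankel m0 m1 m2 m3 m4)"
  obtains t where "1 / 3 \<le> t" "t < 1" "orbit_rel (hankel 1 0 t 0 1) (hankel m0 m1 m2 m3 m4)"
proof -
  obtain n0 n1 n2 n4 where n: "orbit_rel (hankel m0 m1 m2 m3 m4) (hankel n0 n1 n2 n1 n4)"
      "n0 + n4 = 6 * n2"
    using assms by (rule hankel_orbit_root_at_i)
  obtain k0 k2 k4 where k: "orbit_rel (hankel n0 n1 n2 n1 n4) (hankel k0 0 k2 0 k4)"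
      "k0 + k4 = 6 * k2"
    using n(2) by (rule hankel_orbit_even)
  note mk = orbit_rel_trans[OF n(1) k(1)]
  note pdk = orbit_rel_pos_def[OF mk assms]
  have pos: "k0 > 0" "k4 > 0"
    using pos_def_hankel[OF pdk, of 1 0 0] pos_def_hankel[OF pdk, of 0 0 1] by simp_all
  define a d where "a = 1 / root 4 k4" and "d = 1 / root 4 k0"
  have ad: "a > 0" "d > 0" "a^4 * k4 = 1" "d^4 * k0 = 1"
    using pos by (simp_all add: a_def d_def power_divide)
  define t where "t = a\<^sup>2 * d\<^sup>2 * k2"
  have "A_mat a 0 0 d ** hankel k0 0 k2 0 k4 ** transpose (A_mat a 0 0 d) = hankel 1 0 t 0 1"
    unfolding hankel_congruence using ad by (simp add: t_def)
  then have kt: "orbit_rel (hankel k0 0 k2 0 k4) (hankel 1 0 t 0 1)"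
    using orbit_rel_A_mat[of a d 0 0 "hankel k0 0 k2 0 k4"] ad by simp
  have "a\<^sup>2 * d\<^sup>2 * (6 * t - 2) = (a\<^sup>2 - d\<^sup>2)\<^sup>2"
    unfolding t_def using ad(3,4) k(2) by algebra
  then have "0 \<le> a\<^sup>2 * d\<^sup>2 * (6 * t - 2)"
    by simp
  moreover have "0 < a\<^sup>2 * d\<^sup>2"
    using ad by simp
  ultimately have "0 \<le> 6 * t - 2"
    by (metis mult_pos_neg not_le)
  then have "1 / 3 \<le> t"
    by simp
  moreover have "t < 1"
    using pos_def_hankel[OF orbit_rel_pos_def[OF kt pdk], of 1 0 "-1"] by simp
  moreover have "orbit_rel (hankel 1 0 t 0 1) (hankel m0 m1 m2 m3 m4)"
    using orbit_rel_sym orbit_rel_trans mk kt by blast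
  ultimately show thesis
    using that by blast
qed

section \<open>The integral for the normal form\<close>

text \<open>The scalar inequality left over from the chord estimate. After squaring, everything is
  expressed in \<open>p\<close>, s = 1 + p^2 and q = a b, where q^2 = 2 s^2 + p^2; equality can
  occur only at p = 1.\<close>

lemma normal_form_constant_bound:
  fixes p a b h :: real
  assumes pos: "p > 0" "a > 0" "b > 0" "h > 0"
    and a2: "a\<^sup>2 = 2 + p\<^sup>2" and b2: "b\<^sup>2 = 1 + 2 * p\<^sup>2" and h2: "h\<^sup>2 = 1 + p\<^sup>2"
  shows "sqrt (2 / 3) * ((a + b) * h) \<le> a * b - p + h\<^sup>2" (is "?Y \<le> ?X")
    and "p \<noteq> 1 \<Longrightarrow> sqrt (2 / 3) * ((a + b) * h) < a * b - p + h\<^sup>2"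
proof -
  define s q where "s = h\<^sup>2" and "q = a * b"
  have q2: "q\<^sup>2 = 2 * s\<^sup>2 + p\<^sup>2"
    unfolding s_def q_def power_mult_distrib a2 b2 h2 by algebra
  have sp: "s - 2 * p = (1 - p)\<^sup>2"
    unfolding s_def h2 by algebra
  have q: "q > 0" and s: "s > 0"
    using pos by (simp_all add: q_def s_def)
  have s2p: "2 * p \<le> s"
    using sp zero_le_power2[of "1 - p"] by linarith
  have Y2: "?Y\<^sup>2 = 2 / 3 * (s * (3 * s + 2 * q))"
  proof -
    have "(a + b)\<^sup>2 = 3 * s + 2 * q"
      unfolding power2_sum a2 b2 s_def h2 q_def by simp
    then show ?thesis
      by (simp add: power_mult_distrib s_def)
  qed
  have diff: "?X\<^sup>2 - ?Y\<^sup>2 = (s - p)\<^sup>2 + p\<^sup>2 + 2 / 3 * q * (s - 3 * p)"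
  proof -
    have "?X = q - p + s"
      by (simp add: q_def s_def)
    then show ?thesis
      using q2 unfolding Y2 by (simp add: power2_eq_square algebra_simps diff_divide_distrib)
  qed
  have key: "0 \<le> ?X\<^sup>2 - ?Y\<^sup>2 \<and> (p \<noteq> 1 \<longrightarrow> 0 < ?X\<^sup>2 - ?Y\<^sup>2)"
  proof (cases "3 * p \<le> s")
    case True
    then have "0 \<le> 2 / 3 * q * (s - 3 * p)"
      using q by simp
    moreover have "0 < (s - p)\<^sup>2 + p\<^sup>2"
      using pos by (simp add: add_nonneg_pos)
    ultimately show ?thesis
      unfolding diff by linarith
  next
    case False
    \<comment> \<open>AM-GM is applied with equality at q = 3 p, which holds at p = 1. The remainder
      below then contains the factor s - 2 p = (1 - p)^2.\<close>
    have "0 \<le> (q - 3 * p)\<^sup>2"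
      by simp
    then have "3 * p * q \<le> s\<^sup>2 + 5 * p\<^sup>2"
      using q2 by (simp add: power2_eq_square algebra_simps)
    then have "3 * p * q * (2 * (3 * p - s)) \<le> (s\<^sup>2 + 5 * p\<^sup>2) * (2 * (3 * p - s))"
      using False by (intro mult_right_mono) auto
    moreover have "9 * p * (?X\<^sup>2 - ?Y\<^sup>2) = 9 * p * ((s - p)\<^sup>2 + p\<^sup>2) - 3 * p * q * (2 * (3 * p - s))"
      unfolding diff by (simp add: algebra_simps diff_divide_distrib)
    moreover have "9 * p * ((s - p)\<^sup>2 + p\<^sup>2) - (s\<^sup>2 + 5 * p\<^sup>2) * (2 * (3 * p - s))
        = (s - 2 * p) * ((2 * s + 3 * p) * (s + 2 * p))"
      by algebra
    ultimately have le: "(s - 2 * p) * ((2 * s + 3 * p) * (s + 2 * p)) \<le> 9 * p * (?X\<^sup>2 - ?Y\<^sup>2)"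
      by linarith
    have fac: "0 < (2 * s + 3 * p) * (s + 2 * p)"
      using pos s by simp
    have "0 \<le> 9 * p * (?X\<^sup>2 - ?Y\<^sup>2)"
      using le fac s2p by (smt (verit) mult_nonneg_nonneg)
    moreover have "0 < 9 * p * (?X\<^sup>2 - ?Y\<^sup>2)" if "p \<noteq> 1"
    proof -
      have "0 < s - 2 * p"
        using sp that by simp
      with le fac show ?thesis
        by (smt (verit) mult_pos_pos)
    qed
    ultimately show ?thesis
      using pos(1) by (auto simp: zero_le_mult_iff zero_less_mult_iff)
  qed
  have "0 \<le> ?X"
    using q s2p pos(1) unfolding q_def s_def by linarith
  with key show "?Y \<le> ?X" "p \<noteq> 1 \<Longrightarrow> ?Y < ?X"
    by (auto intro: power2_le_imp_le power_less_imp_less_base[where n=2])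
qed


text \<open>\<open>quartic t\<close> is, up to a factor, the Gram determinant in the integrand of \<open>Vol1\<close> for
  the inverse of \<open>hankel 1 0 t 0 1\<close>, and \<open>hess t\<close> is its Hessian, the denominator. Both are
  controlled by powers of \<open>1 + x\<^sup>2\<close> because the pencil they span contains a perfect square.\<close>

definition quartic :: "real \<Rightarrow> real \<Rightarrow> real" where
  "quartic t x = 1 + 6 * t * x\<^sup>2 + x^4"

definition hess :: "real \<Rightarrow> real \<Rightarrow> real" where
  "hess t x = t + (1 - 3 * t\<^sup>2) * x\<^sup>2 + t * x^4"

text \<open>Lets \<open>quartic t x\<close> in a numerator over \<open>hess t x\<close> be traded
  for (1 + x^2)^2 and \<open>hess t x\<close> itself, leaving rational integrands.\<close>

lemma pencil_square:
  "(1 + t) / 2 * quartic t x + hess t x = (1 + 3 * t) / 2 * (1 + x\<^sup>2)\<^sup>2"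
  by (simp add: quartic_def hess_def power2_eq_square power4_eq_xxxx field_simps)

lemma has_bochner_integral_over_hess:
  assumes t: "1 / 3 \<le> t" "t < 1"
  shows "has_bochner_integral lborel (\<lambda>x. (1 + x\<^sup>2) / hess t x)
      (2 * pi / sqrt (t * (1 - t) * (1 + 3 * t)))"
    and "hess t x > 0"
proof -
  \<comment> \<open>Chosen so that \<open>hess t x\<close> is t ((1 + x^2)^2 - k^2 x^2), with
    \<open>k\<close> real because \<open>1 / 3 \<le> t\<close>. The two factors have roots with real
    parts k/2 and -k/2 and imaginary parts \<open>s\<close> and \<open>- s\<close>.\<close>
  define k where "k = sqrt ((3 * t - 1) * (1 + t) / t)"
  define s where "s = sqrt ((1 - t) * (1 + 3 * t) / (4 * t))"
  have s: "s > 0" using t by (simp add: s_def)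
  have k2: "t * k\<^sup>2 = (3 * t - 1) * (1 + t)"
    using t by (simp add: k_def)
  have s2: "4 * t * s\<^sup>2 = (1 - t) * (1 + 3 * t)"
    using t by (simp add: s_def)
  have "t * (4 * s\<^sup>2 + k\<^sup>2) = t * 4"
    using k2 s2 by algebra
  then have ks: "4 * s\<^sup>2 + k\<^sup>2 = 4"
    using t by simp
  have quad: "(x - k / 2)\<^sup>2 + s\<^sup>2 = 1 + x\<^sup>2 - k * x" "(x + k / 2)\<^sup>2 + s\<^sup>2 = 1 + x\<^sup>2 + k * x" for x
    using ks by (simp_all add: power2_eq_square field_simps)
  have pos: "1 + x\<^sup>2 - k * x > 0" "1 + x\<^sup>2 + k * x > 0" for x
    unfolding quad[symmetric] using s by (simp_all add: add_nonneg_pos)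
  have fac: "hess t x = t * ((1 + x\<^sup>2 - k * x) * (1 + x\<^sup>2 + k * x))" for x
    using k2 unfolding hess_def by algebra
  show "hess t x > 0"
    using pos[of x] t by (simp add: fac)
  have "has_bochner_integral lborel
      (\<lambda>x. 1 / (2 * t) * (1 / ((x - k / 2)\<^sup>2 + s\<^sup>2) + 1 / ((x - (- k / 2))\<^sup>2 + s\<^sup>2)))
      (1 / (2 * t) * (pi / s + pi / s))"
    by (intro has_bochner_integral_mult_right has_bochner_integral_add
        has_bochner_integral_inverse_quadratic s)
  moreover have "1 / (2 * t) * (1 / ((x - k / 2)\<^sup>2 + s\<^sup>2) + 1 / ((x - (- k / 2))\<^sup>2 + s\<^sup>2))
      = (1 + x\<^sup>2) / hess t x" for x
  proof -
    have "1 / (2 * t) * (1 / u + 1 / v) = w / (t * (u * v))"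
      if "u > 0" "v > 0" "u + v = 2 * w" for u v w
    proof -
      have "1 / u + 1 / v = 2 * w / (u * v)"
        using that by (simp add: field_simps)
      then show ?thesis
        using t by simp
    qed
    note this[OF pos(1)[of x] pos(2)[of x], of "1 + x\<^sup>2"]
    moreover have "(x - (- k / 2))\<^sup>2 + s\<^sup>2 = 1 + x\<^sup>2 + k * x"
      using quad(2)[of x] by simp
    ultimately show ?thesis
      unfolding fac quad(1) by simp
  qed
  moreover have "1 / (2 * t) * (pi / s + pi / s) = 2 * pi / sqrt (t * (1 - t) * (1 + 3 * t))"
  proof -
    have "sqrt (t * (1 - t) * (1 + 3 * t)) = sqrt ((2 * t * s)\<^sup>2)"
      using s2 by (intro arg_cong[where f=sqrt]) algebra
    also have "\<dots> = 2 * t * s"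
      using s t by simp
    finally show ?thesis
      by simp
  qed
  ultimately show "has_bochner_integral lborel (\<lambda>x. (1 + x\<^sup>2) / hess t x)
      (2 * pi / sqrt (t * (1 - t) * (1 + 3 * t)))"
    by simp
qed

text \<open>After squaring, the gaps are multiples of (3 t - 1) x^2 and (3 t - 1)(1 - x^2)^2, so
  both bounds are exact at \<open>t = 1 / 3\<close>.\<close>

lemma sqrt_quartic_bounds:
  assumes t: "1 / 3 \<le> t"
  defines "K \<equiv> sqrt ((1 + 3 * t) / 2)"
  shows "1 + x\<^sup>2 \<le> sqrt (quartic t x)" "sqrt (quartic t x) \<le> K * (1 + x\<^sup>2)"
proof -
  have "0 \<le> (3 * t - 1) * x\<^sup>2"
    using t by simp
  then have "(1 + x\<^sup>2)\<^sup>2 \<le> quartic t x"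
    unfolding quartic_def by (simp add: power2_eq_square power4_eq_xxxx algebra_simps)
  then show "1 + x\<^sup>2 \<le> sqrt (quartic t x)"
    by (rule real_le_rsqrt)
  have "0 \<le> (3 * t - 1) / 2 * (1 - x\<^sup>2)\<^sup>2"
    using t by simp
  then have "quartic t x \<le> (1 + 3 * t) / 2 * (1 + x\<^sup>2)\<^sup>2"
    unfolding quartic_def by (simp add: power2_eq_square power4_eq_xxxx field_simps)
  then have "sqrt (quartic t x) \<le> sqrt ((1 + 3 * t) / 2 * (1 + x\<^sup>2)\<^sup>2)"
    by (rule real_sqrt_le_mono)
  also have "\<dots> = K * (1 + x\<^sup>2)"
    unfolding K_def real_sqrt_mult by simp
  finally show "sqrt (quartic t x) \<le> K * (1 + x\<^sup>2)" .
qed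

lemma integrable_sqrt_quartic_over_hess:
  assumes t: "1 / 3 \<le> t" "t < 1"
  shows "integrable lborel (\<lambda>x. sqrt (quartic t x) / hess t x)"
proof (rule Bochner_Integration.integrable_bound)
  show "integrable lborel (\<lambda>x. sqrt ((1 + 3 * t) / 2) * ((1 + x\<^sup>2) / hess t x))"
    using has_bochner_integral_over_hess(1)[OF t]
    by (intro integrable_mult_right) (simp add: has_bochner_integral_iff)
  show "(\<lambda>x. sqrt (quartic t x) / hess t x) \<in> borel_measurable lborel"
    unfolding quartic_def hess_def by measurable
  have "\<bar>sqrt (quartic t x) / hess t x\<bar> \<le> \<bar>sqrt ((1 + 3 * t) / 2) * ((1 + x\<^sup>2) / hess t x)\<bar>" for x
  proof -
    have "0 \<le> sqrt (quartic t x)" "sqrt (quartic t x) \<le> sqrt ((1 + 3 * t) / 2) * (1 + x\<^sup>2)"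
      using sqrt_quartic_bounds[OF t(1), of x] zero_le_power2[of x] by linarith+
    then show ?thesis
      using has_bochner_integral_over_hess(2)[OF t, of x] t(1)
      by (auto simp: abs_mult abs_divide divide_right_mono)
  qed
  then show "AE x in lborel. norm (sqrt (quartic t x) / hess t x)
      \<le> norm (sqrt ((1 + 3 * t) / 2) * ((1 + x\<^sup>2) / hess t x))"
    by simp
qed

text \<open>Integrating the chord bound \<open>(y - n) (K n - y) \<ge> 0\<close> for \<open>n = 1 + x\<^sup>2\<close> and
  \<open>y = sqrt (quartic t x)\<close>.\<close>

lemma integral_sqrt_quartic_over_hess_ge:
  assumes t: "1 / 3 \<le> t" "t < 1"
  defines "K \<equiv> sqrt ((1 + 3 * t) / 2)"
    and "I \<equiv> 2 * pi / sqrt (t * (1 - t) * (1 + 3 * t))"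
  shows "(2 / (1 + t) * (K\<^sup>2 * I - pi) + K * I) / (1 + K)
    \<le> (\<integral>x. sqrt (quartic t x) / hess t x \<partial>lborel)"
proof -
  have K: "K > 0" "K\<^sup>2 = (1 + 3 * t) / 2"
    using t by (simp_all add: K_def)
  \<comment> \<open>The chord bound divided by n \<open>hess t x\<close> (1 + K), with y^2
    eliminated by \<open>pencil_square\<close>. The last quadratic is spelled
    \<open>(x - 0)\<^sup>2 + 1\<^sup>2\<close> to match the rational integral.\<close>
  define L where "L x = (2 / (1 + t) * (K\<^sup>2 * ((1 + x\<^sup>2) / hess t x) - 1 / ((x - 0)\<^sup>2 + 1\<^sup>2))
      + K * ((1 + x\<^sup>2) / hess t x)) / (1 + K)" for x
  have L: "has_bochner_integral lborel L
      ((2 / (1 + t) * (K\<^sup>2 * I - pi / 1) + K * I) / (1 + K))"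
    unfolding L_def I_def
    by (intro has_bochner_integral_divide has_bochner_integral_add has_bochner_integral_mult_right
        has_bochner_integral_diff has_bochner_integral_over_hess(1) t
        has_bochner_integral_inverse_quadratic) auto
  have "L x \<le> sqrt (quartic t x) / hess t x" for x
  proof -
    define n y H where "n = 1 + x\<^sup>2" and "y = sqrt (quartic t x)" and "H = hess t x"
    have n: "n > 0" by (simp add: n_def add_pos_nonneg)
    have H: "H > 0" using has_bochner_integral_over_hess(2)[OF t] by (simp add: H_def)
    have y: "n \<le> y" "y \<le> K * n"
      using sqrt_quartic_bounds[OF t(1), of x] by (simp_all add: n_def y_def K_def)
    have "0 < sqrt (quartic t x)"
      using y(1) n unfolding y_def by linarith
    then have y2: "y\<^sup>2 = quartic t x"
      by (simp add: y_def)
    have "(1 + t) / 2 * y\<^sup>2 = K\<^sup>2 * n\<^sup>2 - H"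
      using pencil_square[of t x] by (simp add: y2 K n_def H_def)
    then have y2': "y\<^sup>2 = 2 / (1 + t) * (K\<^sup>2 * n\<^sup>2 - H)"
      using t by (simp add: field_simps)
    have "0 \<le> (y - n) * (K * n - y)"
      using y by simp
    then have "y\<^sup>2 + K * n\<^sup>2 \<le> y * (n * (1 + K))"
      by (simp add: power2_eq_square algebra_simps)
    then have "(y\<^sup>2 + K * n\<^sup>2) / (n * H * (1 + K)) \<le> y * (n * (1 + K)) / (n * H * (1 + K))"
      using n H K by (intro divide_right_mono) auto
    also have "\<dots> = y / H"
      using n K by simp
    also have "(y\<^sup>2 + K * n\<^sup>2) / (n * H * (1 + K)) = L x"
    proof -
      have "y\<^sup>2 / (n * H) = 2 / (1 + t) * (K\<^sup>2 * (n / H) - 1 / n)"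
        unfolding y2' using n H by (simp add: power2_eq_square diff_divide_distrib right_diff_distrib)
      moreover have "K * n\<^sup>2 / (n * H) = K * (n / H)"
        using n by (simp add: power2_eq_square)
      moreover have "(x - 0)\<^sup>2 + 1\<^sup>2 = n"
        by (simp add: n_def)
      ultimately have "L x = (y\<^sup>2 / (n * H) + K * n\<^sup>2 / (n * H)) / (1 + K)"
        unfolding L_def by (simp only: n_def H_def)
      then show ?thesis
        by (simp add: add_divide_distrib)
    qed
    finally show ?thesis
      by (simp add: y_def H_def)
  qed
  then have "integral\<^sup>L lborel L \<le> (\<integral>x. sqrt (quartic t x) / hess t x \<partial>lborel)"
    using L integrable_sqrt_quartic_over_hess[OF t]
    by (intro integral_mono) (auto simp: has_bochner_integral_iff)
  then show ?thesis
    using L by (simp add: has_bochner_integral_iff)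
qed

text \<open>The chord estimate combined with the scalar inequality in \<open>p\<close>. Strictness
  carries over since \<open>p = 1\<close> means \<open>t = 1 / 3\<close>.\<close>

lemma sqrt_quartic_over_hess_estimate:
  assumes t: "1 / 3 \<le> t" "t < 1"
  shows "2 * pi * sqrt (2 / 3) \<le> sqrt (t * (1 - t\<^sup>2)) * (\<integral>x. sqrt (quartic t x) / hess t x \<partial>lborel)"
      (is "_ \<le> ?V")
    and "t \<noteq> 1 / 3 \<Longrightarrow>
      2 * pi * sqrt (2 / 3) < sqrt (t * (1 - t\<^sup>2)) * (\<integral>x. sqrt (quartic t x) / hess t x \<partial>lborel)"
proof -
  \<comment> \<open>In this parameter \<open>t = 1 / (1 + 2 p\<^sup>2)\<close>, and all radicands become squares of monomials in
    \<open>p\<close>, \<open>a\<close>, \<open>b\<close>, \<open>h\<close>.\<close>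
  define p where "p = sqrt ((1 - t) / (2 * t))"
  have p: "p > 0" "2 * t * p\<^sup>2 = 1 - t"
    using t by (simp_all add: p_def)
  define a b h where "a = sqrt (2 + p\<^sup>2)" and "b = sqrt (1 + 2 * p\<^sup>2)" and "h = sqrt (1 + p\<^sup>2)"
  have sq: "a\<^sup>2 = 2 + p\<^sup>2" "b\<^sup>2 = 1 + 2 * p\<^sup>2" "h\<^sup>2 = 1 + p\<^sup>2"
    by (simp_all add: a_def b_def h_def)
  have pos: "a > 0" "b > 0" "h > 0"
    by (simp_all add: a_def b_def h_def add_pos_nonneg)
  have tb: "t * b\<^sup>2 = 1"
    unfolding sq using p(2) by algebra
  have t1: "t = 1 / b\<^sup>2"
    using tb pos by (simp add: field_simps)
  have t2: "1 + t = 2 * h\<^sup>2 / b\<^sup>2" "1 - t = 2 * p\<^sup>2 / b\<^sup>2" "1 + 3 * t = 2 * a\<^sup>2 / b\<^sup>2"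
    unfolding t1 sq by (simp_all add: field_simps add_pos_nonneg less_imp_neq[THEN not_sym])
  have K: "sqrt ((1 + 3 * t) / 2) = a / b"
    unfolding t2 using pos by (simp add: real_sqrt_divide)
  have J: "sqrt (t * (1 - t\<^sup>2)) = 2 * p * h / b^3"
  proof (rule real_sqrt_unique)
    have "t * (1 - t\<^sup>2) = t * ((1 - t) * (1 + t))"
      by algebra
    also have "\<dots> = (2 * p * h / b^3)\<^sup>2"
      unfolding t2 unfolding t1 by (simp add: power_divide power_mult_distrib flip: power_mult power_add)
    finally show "(2 * p * h / b^3)\<^sup>2 = t * (1 - t\<^sup>2)" by simp
    show "0 \<le> 2 * p * h / b^3"
      using p pos by simp
  qed
  have I: "sqrt (t * (1 - t) * (1 + 3 * t)) = 2 * p * a / b^3"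
  proof (rule real_sqrt_unique)
    show "(2 * p * a / b^3)\<^sup>2 = t * (1 - t) * (1 + 3 * t)"
      unfolding t2 unfolding t1 by (simp add: power_divide power_mult_distrib flip: power_mult power_add)
    show "0 \<le> 2 * p * a / b^3"
      using p pos by simp
  qed
  \<comment> \<open>The right side is the prefactor times the chord bound in the new parameters; its
    ratio to the target constant is the quotient compared in
    \<open>normal_form_constant_bound\<close>.\<close>
  have "2 * pi / ((a + b) * h) * (a * b - p + h\<^sup>2) =
      2 * p * h / b^3 * ((2 / (2 * h\<^sup>2 / b\<^sup>2) * ((a / b)\<^sup>2 * (2 * pi / (2 * p * a / b^3)) - pi)
        + a / b * (2 * pi / (2 * p * a / b^3))) / (1 + a / b))"
  proof -
    have "2 / (2 * h\<^sup>2 / b\<^sup>2) * ((a / b)\<^sup>2 * (2 * pi / (2 * p * a / b^3)) - pi)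
        + a / b * (2 * pi / (2 * p * a / b^3)) = pi * b\<^sup>2 / (p * h\<^sup>2) * (a * b - p + h\<^sup>2)"
      using pos p(1) by (simp add: field_simps power2_eq_square power3_eq_cube)
    moreover have "1 + a / b = (a + b) / b"
      using pos by (simp add: field_simps)
    moreover have "2 * p * h / b^3 * (pi * b\<^sup>2 / (p * h\<^sup>2) * w / (c / b)) = 2 * pi / (c * h) * w"
      if "c > 0" for w c
      using that pos p(1) by (simp add: field_simps power2_eq_square power3_eq_cube)
    moreover have "a + b > 0"
      using pos by simp
    ultimately show ?thesis by simp
  qed
  also have "\<dots> \<le> ?V"
    unfolding J using integral_sqrt_quartic_over_hess_ge[OF t] p(1) pos unfolding K I t2(1)
    by (intro mult_left_mono) auto
  finally have le: "2 * pi / ((a + b) * h) * (a * b - p + h\<^sup>2) \<le> ?V" .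
  have c: "2 * pi / ((a + b) * h) > 0"
    using pos by (simp add: add_pos_pos)
  have eq: "2 * pi * sqrt (2 / 3) = 2 * pi / ((a + b) * h) * (sqrt (2 / 3) * ((a + b) * h))"
    using pos by simp
  show "2 * pi * sqrt (2 / 3) \<le> ?V"
    unfolding eq
    by (rule order_trans[OF mult_left_mono le]) (use normal_form_constant_bound(1)[OF p(1) pos sq] c in auto)
  assume "t \<noteq> 1 / 3"
  then have "p \<noteq> 1"
    using p(2) by auto
  then show "2 * pi * sqrt (2 / 3) < ?V"
    unfolding eq
    by (intro less_le_trans[OF mult_strict_left_mono le] normal_form_constant_bound(2)[OF p(1) pos sq] c)
qed

text \<open>Here the quartic is a perfect square, so the integral is exactly the rational
  one.\<close>

lemma sqrt_quartic_over_hess_third: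
  "sqrt (1 / 3 * (1 - (1 / 3)\<^sup>2)) * (\<integral>x. sqrt (quartic (1 / 3) x) / hess (1 / 3) x \<partial>lborel)
    = 2 * pi * sqrt (2 / 3)"
proof -
  have q: "quartic (1 / 3) x = (1 + x\<^sup>2)\<^sup>2" for x
    by (simp add: quartic_def power2_eq_square power4_eq_xxxx algebra_simps)
  have "(\<integral>x. (1 + x\<^sup>2) / hess (1 / 3) x \<partial>lborel) = 2 * pi / sqrt (4 / 9)"
    using has_bochner_integral_over_hess(1)[of "1 / 3"] by (simp add: has_bochner_integral_iff)
  moreover have "sqrt (4 / 9) = 2 / 3"
    by (simp add: real_sqrt_divide)
  moreover have "sqrt (1 / 3 * (1 - (1 / 3)\<^sup>2)) = 2 / 3 * sqrt (2 / 3)"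
    by (rule real_sqrt_unique) (simp_all add: power2_eq_square)
  ultimately show ?thesis
    unfolding q by simp
qed

section \<open>Moment matrices\<close>

lemma Vol1_inverse_normal_form:
  assumes t: "1 / 3 \<le> t" "t < 1" and A: "A \<in> A_group"
  shows "Vol1 (matrix_inv (A ** hankel 1 0 t 0 1 ** transpose A)) =
    2 * (sqrt (t * (1 - t\<^sup>2)) * (\<integral>x. sqrt (quartic t x) / hess t x \<partial>lborel))"
proof -
  have "t\<^sup>2 < 1"
    using t by (simp add: power_less_one_iff abs_square_less_1)
  define e i where "e = 1 / (1 - t\<^sup>2)" and "i = 1 / t"
  have e: "e > 0" "e * (1 - t\<^sup>2) = 1" and i: "i > 0" "i * t = 1"
    using t \<open>t\<^sup>2 < 1\<close> by (simp_all add: e_def i_def)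
  define N :: "real^3^3" where
    "N = vector [vector [e, 0, - t * e], vector [0, i, 0], vector [- t * e, 0, e]]"
  have "e - t * (t * e) = 1" "t * i = 1"
    using e(2) i(2) by algebra+
  then have inv: "hankel 1 0 t 0 1 ** N = mat 1"
    by (simp add: hankel_def N_def vec_eq_iff forall_3 matrix_matrix_mult_def sum_3 mat_def)
  have sym: "transpose (hankel 1 0 t 0 1) = hankel 1 0 t 0 1"
    by (simp add: hankel_def vec_eq_iff forall_3 transpose_def)
  have "sqrt ((fP x \<bullet> (N *v fP x)) * (gP x \<bullet> (N *v gP x)) - (fP x \<bullet> (N *v gP x))\<^sup>2)
       / (fP x \<bullet> (N *v fP x)) = sqrt (t * (1 - t\<^sup>2)) * (sqrt (quartic t x) / hess t x)" for x
  proof -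
    have ff: "fP x \<bullet> (N *v fP x) = e * (1 - 2 * t * x\<^sup>2 + x^4) + i * x\<^sup>2"
      and fg: "fP x \<bullet> (N *v gP x) = e * (2 * x^3 - 2 * t * x) + i * x"
      and gg: "gP x \<bullet> (N *v gP x) = i + 4 * x\<^sup>2 * e"
      by (simp_all add: fP_def gP_def N_def inner_vec_def matrix_vector_mult_def sum_3
          power2_eq_square power3_eq_cube power4_eq_xxxx algebra_simps)
    have ff': "fP x \<bullet> (N *v fP x) = e * i * hess t x"
      unfolding ff hess_def using e(2) i(2) by algebra
    \<comment> \<open>Cauchy-Binet: \<open>e * i\<close> is the determinant of \<open>N\<close>, and
      the cross product of \<open>fP x\<close> and \<open>gP x\<close> is (x^2, -2x, 1), the
      coefficient vector of (x - s)^2, on which the Hankel form equals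
      \<open>quartic t x\<close>.\<close>
    have gram: "(fP x \<bullet> (N *v fP x)) * (gP x \<bullet> (N *v gP x)) - (fP x \<bullet> (N *v gP x))\<^sup>2
        = e * i * quartic t x"
      unfolding ff fg gg quartic_def using e(2) i(2) by algebra
    have "t * (1 - t\<^sup>2) = 1 / (e * i)"
      using t \<open>t\<^sup>2 < 1\<close> by (simp add: e_def i_def)
    moreover have "sqrt (e * i * y) / (e * i * z) = sqrt (1 / (e * i)) * (sqrt y / z)" for y z
    proof -
      have "sqrt (e * i) / (e * i) = sqrt (1 / (e * i))"
        using e(1) i(1) sqrt_divide_self_eq[of "e * i"]
        by (simp only: real_sqrt_divide real_sqrt_one inverse_eq_divide mult_nonneg_nonneg less_imp_le)
      then show ?thesis
        by (metis real_sqrt_mult times_divide_times_eq)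
    qed
    ultimately show ?thesis
      unfolding gram unfolding ff' by simp
  qed
  then have "Vol1 N = 2 * (sqrt (t * (1 - t\<^sup>2)) * (\<integral>x. sqrt (quartic t x) / hess t x \<partial>lborel))"
    by (simp only: Vol1_def integral_mult_right_zero)
  then show ?thesis
    using Vol1_matrix_inv_congruence[OF sym inv A] by simp
qed

text \<open>The (1,3) and (2,2) entries both integrate x^2, and symmetry gives the rest. Taking an
  entry is bounded linear, so it commutes with the Bochner integral.\<close>

lemma moment_matrix_hankel:
  assumes "M \<in> moment_matrices"
  obtains m0 m1 m2 m3 m4 where "M = hankel m0 m1 m2 m3 m4"
proof -
  from assms obtain \<rho> :: "real measure" where sym: "transpose M = M"
    and int: "integrable \<rho> (\<lambda>x. outer_prod (fP x) (fP x))"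
    and M: "M = (\<integral>x. outer_prod (fP x) (fP x) \<partial>\<rho>)"
    by (auto simp: moment_matrices_def pos_def_mat_def)
  have entry: "M $ i $ j = (\<integral>x. outer_prod (fP x) (fP x) $ i $ j \<partial>\<rho>)" for i j
  proof -
    have "bounded_linear (\<lambda>X :: real^3^3. X $ i $ j)"
      by (intro bounded_linear_compose[OF bounded_linear_vec_nth bounded_linear_vec_nth, unfolded o_def])
    from integral_bounded_linear[OF this int] show ?thesis
      by (simp add: M)
  qed
  have "M $ 1 $ 3 = M $ 2 $ 2"
    unfolding entry by (simp add: outer_prod_def fP_def power2_eq_square)
  moreover have "M $ i $ j = M $ j $ i" for i j
    by (subst sym[symmetric]) (simp add: transpose_def)
  ultimately have "M = hankel (M$1$1) (M$1$2) (M$1$3) (M$2$3) (M$3$3)"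
    by (simp add: hankel_def vec_eq_iff forall_3)
  then show thesis
    by (rule that)
qed

section \<open>The extremal matrix as a moment matrix\<close>

lemma M_third_hankel: "M_third = hankel 1 0 (1 / 3) 0 1"
  by (simp add: M_third_def hankel_def)

lemma pos_def_M_third: "pos_def_mat M_third"
  unfolding pos_def_mat_def
proof (intro conjI allI impI)
  show "transpose M_third = M_third"
    by (simp add: M_third_def vec_eq_iff forall_3 transpose_def)
  fix v :: "real^3" assume "v \<noteq> 0"
  have "v \<bullet> (M_third *v v) = (v$1 + v$3 / 3)\<^sup>2 + (v$2)\<^sup>2 / 3 + 8 / 9 * (v$3)\<^sup>2"
    by (simp add: M_third_def inner_vec_def matrix_vector_mult_def sum_3 power2_eq_square field_simps)
  moreover have "v$3 \<noteq> 0 \<or> v$2 \<noteq> 0 \<or> v$1 + v$3 / 3 \<noteq> 0"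
    using \<open>v \<noteq> 0\<close> by (auto simp: vec_eq_iff forall_3)
  then have "0 < (v$1 + v$3 / 3)\<^sup>2 + (v$2)\<^sup>2 / 3 + 8 / 9 * (v$3)\<^sup>2"
    by (elim disjE) (simp_all add: add_pos_nonneg add_nonneg_pos)
  ultimately show "0 < v \<bullet> (M_third *v v)" by simp
qed

lemma M_third_in_moment_matrices: "M_third \<in> moment_matrices"
proof -
  \<comment> \<open>Mass 8/9 at 0 and 1/18 at each of the points sqrt 3 and -sqrt 3 gives moments 1,
    0, 1/3, 0, 1.\<close>
  define w :: "real \<Rightarrow> real" where "w x = (if x = 0 then 8 / 9 else 1 / 18)" for x
  define X where "X = {0, sqrt 3, - sqrt 3}"
  have X: "finite X"
    by (simp add: X_def)
  define \<mu> where "\<mu> = point_measure X w"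
  \<comment> \<open>The point measure lives on the power set of \<open>X\<close>; the identity
    pushes it forward to the Borel sets of the line.\<close>
  define \<rho> where "\<rho> = distr \<mu> borel (\<lambda>x. x)"
  define F where "F x = outer_prod (fP x) (fP x)" for x
  have [measurable]: "(\<lambda>x. x) \<in> \<mu> \<rightarrow>\<^sub>M borel"
    by (simp add: \<mu>_def measurable_def)
  have F_meas: "F \<in> borel_measurable borel"
  proof (rule borel_measurable_continuous_onI)
    have "continuous_on UNIV fP"
      using fP_has_vector_derivative has_vector_derivative_continuous
      by (metis continuous_at_imp_continuous_on)
    then show "continuous_on UNIV F"
      unfolding F_def outer_prod_def by (intro continuous_intros)
  qed
  have "finite_measure \<mu>"
    unfolding \<mu>_def point_measure_def using X
    by (intro finite_measureI) (simp add: emeasure_density nn_integral_count_space_finite)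
  then have "finite_measure \<rho>"
    unfolding \<rho>_def by (rule finite_measure.finite_measure_distr) measurable
  moreover have "sets \<rho> = sets borel"
    by (simp add: \<rho>_def)
  moreover have "integrable \<rho> F"
    unfolding \<rho>_def by (subst integrable_distr_eq) (use F_meas X in \<open>simp_all add: \<mu>_def integrable_point_measure_finite\<close>)
  moreover have "M_third = integral\<^sup>L \<rho> F"
  proof -
    have "integral\<^sup>L \<rho> F = integral\<^sup>L \<mu> F"
      unfolding \<rho>_def using F_meas by (subst integral_distr) simp_all
    also have "\<dots> = (\<Sum>x\<in>X. w x *\<^sub>R F x)"
      unfolding \<mu>_def using X by (rule lebesgue_integral_point_measure_finite) (simp add: w_def)
    also have "\<dots> = M_third"
    proof -
      have "sqrt 3 \<noteq> - sqrt 3"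
        by (metis less_numeral_extra(3) neg_less_0_iff_less real_sqrt_gt_zero zero_less_numeral order.asym)
      then show ?thesis
        by (simp add: X_def w_def F_def outer_prod_def fP_def M_third_def vec_eq_iff forall_3)
    qed
    finally show ?thesis ..
  qed
  ultimately show ?thesis
    unfolding moment_matrices_def F_def using pos_def_M_third by blast
qed

theorem theorem4p6:
  "(\<forall>M \<in> moment_matrices.
      is_arg_min (\<lambda>N. Vol1 (matrix_inv N)) (\<lambda>N. N \<in> moment_matrices) M
        \<longleftrightarrow> (\<exists>A \<in> A_group. M = A ** M_third ** transpose A)) \<and>
   (\<exists>M \<in> moment_matrices. Vol1 (matrix_inv M) = 4 * pi * sqrt (2 / 3)) \<and>
   (\<forall>M \<in> moment_matrices. 4 * pi * sqrt (2 / 3) \<le> Vol1 (matrix_inv M))"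
proof -
  have third: "Vol1 (matrix_inv (A ** M_third ** transpose A)) = 4 * pi * sqrt (2 / 3)"
    if "A \<in> A_group" for A
    using that sqrt_quartic_over_hess_third
    by (simp add: M_third_hankel Vol1_inverse_normal_form)
  have "mat 1 \<in> A_group"
    unfolding A_group_def A_mat_1[symmetric] by force
  from third[OF this] have att: "Vol1 (matrix_inv M_third) = 4 * pi * sqrt (2 / 3)"
    by (simp add: transpose_mat)
  \<comment> \<open>Equality forces \<open>t = 1 / 3\<close> in the normal form, so the reducing
    group element is itself the required witness.\<close>
  have bound: "4 * pi * sqrt (2 / 3) \<le> Vol1 (matrix_inv M) \<and>
      (Vol1 (matrix_inv M) = 4 * pi * sqrt (2 / 3) \<longrightarrow> (\<exists>A\<in>A_group. M = A ** M_third ** transpose A))"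
    if M: "M \<in> moment_matrices" for M
  proof -
    obtain m0 m1 m2 m3 m4 where m: "M = hankel m0 m1 m2 m3 m4"
      using M by (rule moment_matrix_hankel)
    have "pos_def_mat (hankel m0 m1 m2 m3 m4)"
      using M by (simp add: moment_matrices_def m)
    then obtain t where t: "1 / 3 \<le> t" "t < 1" and "orbit_rel (hankel 1 0 t 0 1) M"
      unfolding m by (rule hankel_orbit_normal_form)
    then obtain A where A: "A \<in> A_group" "M = A ** hankel 1 0 t 0 1 ** transpose A"
      by (auto simp: orbit_rel_def)
    note V = Vol1_inverse_normal_form[OF t A(1), folded A(2)]
    have "4 * pi * sqrt (2 / 3) \<le> Vol1 (matrix_inv M)"
      unfolding V using sqrt_quartic_over_hess_estimate(1)[OF t] by simp
    moreover have "t = 1 / 3" if "Vol1 (matrix_inv M) = 4 * pi * sqrt (2 / 3)"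
    proof (rule ccontr)
      assume "t \<noteq> 1 / 3"
      from sqrt_quartic_over_hess_estimate(2)[OF t this] that show False
        unfolding V by linarith
    qed
    ultimately show ?thesis
      using A unfolding M_third_hankel by blast
  qed
  \<comment> \<open>As the bound is attained at \<open>M_third\<close>, minimizing is the same as
    reaching the constant.\<close>
  have "is_arg_min (\<lambda>N. Vol1 (matrix_inv N)) (\<lambda>N. N \<in> moment_matrices) M
      \<longleftrightarrow> Vol1 (matrix_inv M) = 4 * pi * sqrt (2 / 3)" if "M \<in> moment_matrices" for M
    using bound that M_third_in_moment_matrices att
  proof -
    have "4 * pi * sqrt (2 / 3) \<le> Vol1 (matrix_inv N)" if "N \<in> moment_matrices" for N
      using bound[OF that] by simp
    then show ?thesis
      using that M_third_in_moment_matrices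
      unfolding is_arg_min_linorder att[symmetric] by (auto intro: antisym)
  qed
  then show ?thesis
    using bound third att M_third_in_moment_matrices by blast
qed

end
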